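(* Let $D$ and $F$ be digraphs. The lexicographic product $D\circ F$ is an ECD digraph if and only if (i) $D$ is a digraph without arcs and $F$ is an ECD digraph, or (ii) $D$ is an ECD digraph and $F$ contains an out-universal vertex.
   Context: Digraphs are finite. The lexicographic product $D\circ F$ has vertex set $V(D)\times V(F)$ and an arc from $(d,f)$ to $(d',f')$ iff $(d,d')\in A(D)$, or $d=d'$ and $(f,f')\in A(F)$. A vertex $v$ of $F$ is out-universal if its out-degree is $|V(F)|-1$ (it has an arc to every other vertex). With $N^+_D[v]=\{v\}\cup\{u:(v,u)\in A(D)\}$, a set $S$ is an ECD set of $D$ if $\{N^+_D[v]:v\in S\}$ is a partition of $V(D)$, and $D$ is an ECD digraph if it has an ECD set. *)

theory Defs
  imports "Graph_Theory.Pair_Digraph" "HOL-Library.Disjoint_Sets"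
begin

definition lexicographic_product ::
    "'a pair_pre_digraph \<Rightarrow> 'b pair_pre_digraph \<Rightarrow> ('a \<times> 'b) pair_pre_digraph" where
  "lexicographic_product D F = \<lparr> pverts = pverts D \<times> pverts F,
     parcs = {((d, f), (d', f')).
       d \<in> pverts D \<and> f \<in> pverts F \<and> d' \<in> pverts D \<and> f' \<in> pverts F \<and>
       ((d, d') \<in> parcs D \<or> (d = d' \<and> (f, f') \<in> parcs F))} \<rparr>"

definition closed_out_nbhd :: "'a pair_pre_digraph \<Rightarrow> 'a \<Rightarrow> 'a set" where
  "closed_out_nbhd D v = {v} \<union> {u. (v, u) \<in> parcs D}"

(* The neighbourhoods are collected in a set, so two vertices of S with the same closed
   out-neighbourhood contribute one block. For the existence of an ECD set this is
   equivalent to counting them separately: see ECD_digraph_iff_dominated_once. *)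
definition ECD_set :: "'a pair_pre_digraph \<Rightarrow> 'a set \<Rightarrow> bool" where
  "ECD_set D S \<longleftrightarrow> S \<subseteq> pverts D \<and> partition_on (pverts D) {closed_out_nbhd D v | v. v \<in> S}"

definition ECD_digraph :: "'a pair_pre_digraph \<Rightarrow> bool" where
  "ECD_digraph D \<longleftrightarrow> (\<exists>S. ECD_set D S)"

definition out_universal :: "'a pair_pre_digraph \<Rightarrow> 'a \<Rightarrow> bool" where
  "out_universal F v \<longleftrightarrow> v \<in> pverts F \<and> out_degree (with_proj F) v = card (pverts F) - 1"

lemma pair_digraph_lexicographic_product:
  assumes "pair_digraph D" "pair_digraph F"
  shows "pair_digraph (lexicographic_product D F)"
proof -
  interpret D: pair_digraph D by fact
  interpret F: pair_digraph F by fact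
  have "parcs (lexicographic_product D F) \<subseteq> (pverts D \<times> pverts F) \<times> (pverts D \<times> pverts F)"
    by (auto simp: lexicographic_product_def)
  then have "finite (parcs (lexicographic_product D F))"
    by (rule finite_subset) (simp add: D.pair_finite_verts F.pair_finite_verts)
  then show ?thesis
    by unfold_locales
      (auto simp: lexicographic_product_def D.pair_finite_verts F.pair_finite_verts
        dest: D.pair_no_loops F.pair_no_loops)
qed

lemma out_universal_iff:
  assumes "pair_digraph F"
  shows "out_universal F v \<longleftrightarrow> v \<in> pverts F \<and> (\<forall>u \<in> pverts F - {v}. (v, u) \<in> parcs F)"
proof -
  interpret pair_digraph F by fact
  define N where "N = {u. (v, u) \<in> parcs F}"
  have "out_arcs (with_proj F) v = Pair v ` N"
    by (auto simp: out_arcs_def N_def)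
  then have deg: "out_degree (with_proj F) v = card N"
    by (simp add: out_degree_def card_image inj_on_def)
  have sub: "N \<subseteq> pverts F - {v}"
    by (auto simp: N_def dest: in_arcsD2 pair_no_loops)
  have fin: "finite (pverts F - {v})"
    using pair_finite_verts by simp
  have "card N = card (pverts F) - 1 \<longleftrightarrow> N = pverts F - {v}" if "v \<in> pverts F"
    using card_subset_eq[OF fin sub] that by (auto simp: card_Diff_singleton)
  then show ?thesis
    using sub by (auto simp: out_universal_def deg N_def)
qed

lemma ECD_digraph_iff_dominated_once:
  assumes "pair_digraph D"
  shows "ECD_digraph D \<longleftrightarrow>
    (\<exists>S \<subseteq> pverts D. \<forall>u \<in> pverts D. \<exists>!v. v \<in> S \<and> u \<in> closed_out_nbhd D v)"
    (is "_ \<longleftrightarrow> ?R")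
proof
  assume "ECD_digraph D"
  then obtain S where S: "S \<subseteq> pverts D" and P: "partition_on (pverts D) (closed_out_nbhd D ` S)"
    by (auto simp: ECD_digraph_def ECD_set_def Setcompr_eq_image)
  obtain T where T: "T \<subseteq> S" and inj: "inj_on (closed_out_nbhd D) T"
    and im: "closed_out_nbhd D ` T = closed_out_nbhd D ` S"
    using subset_image_inj[of "closed_out_nbhd D ` S" "closed_out_nbhd D" S] by auto
  have "\<exists>!v. v \<in> T \<and> u \<in> closed_out_nbhd D v" if "u \<in> pverts D" for u
  proof -
    from that obtain v where v: "v \<in> T" "u \<in> closed_out_nbhd D v"
      using partition_onD1[OF P] im by blast
    have "w = v" if "w \<in> T" "u \<in> closed_out_nbhd D w" for w
    proof -
      have "closed_out_nbhd D w \<in> closed_out_nbhd D ` S" "closed_out_nbhd D v \<in> closed_out_nbhd D ` S"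
        using v(1) that(1) T by auto
      then have "closed_out_nbhd D w = closed_out_nbhd D v"
        using disjointD[OF partition_onD2[OF P]] v(2) that(2) by (meson disjoint_iff)
      then show ?thesis
        using inj_onD[OF inj] v(1) that(1) by simp
    qed
    with v show ?thesis by blast
  qed
  moreover have "T \<subseteq> pverts D"
    using S T by simp
  ultimately show ?R by (intro exI[of _ T] conjI ballI)
next
  interpret pair_digraph D by fact
  assume ?R
  then obtain S where S: "S \<subseteq> pverts D"
    and u: "\<forall>u \<in> pverts D. \<exists>!v. v \<in> S \<and> u \<in> closed_out_nbhd D v"
    by (elim exE conjE)
  have sub: "closed_out_nbhd D v \<subseteq> pverts D" if "v \<in> S" for v
    using that S by (auto simp: closed_out_nbhd_def dest: in_arcsD2)
  have "partition_on (pverts D) (closed_out_nbhd D ` S)"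
  proof (rule partition_onI)
    show "\<Union> (closed_out_nbhd D ` S) = pverts D"
    proof (intro subset_antisym subsetI)
      show "x \<in> pverts D" if "x \<in> \<Union> (closed_out_nbhd D ` S)" for x
        using that sub by auto
      show "x \<in> \<Union> (closed_out_nbhd D ` S)" if "x \<in> pverts D" for x
        using bspec[OF u that] by auto
    qed
    show "disjnt p q" if "p \<in> closed_out_nbhd D ` S" "q \<in> closed_out_nbhd D ` S" "p \<noteq> q" for p q
    proof -
      from that obtain v w where vw: "v \<in> S" "w \<in> S" "p = closed_out_nbhd D v" "q = closed_out_nbhd D w"
        by auto
      have "x \<notin> q" if "x \<in> p" for x
        using bspec[OF u, of x] sub[of v] vw that \<open>p \<noteq> q\<close> by (metis subsetD)
      then show ?thesis by (auto simp: disjnt_def)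
    qed
    show "{} \<notin> closed_out_nbhd D ` S"
      by (auto simp: closed_out_nbhd_def)
  qed
  with S show "ECD_digraph D"
    by (auto simp: ECD_digraph_def ECD_set_def Setcompr_eq_image)
qed

end

theory Submission
  imports Defs
begin

text \<open>
  A vertex \<open>(d, f)\<close> of the product dominates the whole fibre over every out-neighbour of \<open>d\<close>.
  Hence an ECD set of \<open>D \<circ> F\<close> projects to an ECD set of \<open>D\<close>. If \<open>D\<close> has an arc from \<open>u\<close>, the
  vertex that dominates a point of the fibre over \<open>u\<close> lies over some \<open>d\<close> that is not a sink.
  No vertex of the ECD set lies over an in-neighbour of \<open>d\<close>, as it would dominate this vertex
  again, and no second one lies over \<open>d\<close>, as both would dominate the fibre over an out-neighbour
  of \<open>d\<close>. So this one alone dominates the fibre over \<open>d\<close>: its second coordinate is out-universal.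
\<close>

lemma mem_closed_out_nbhd_lexicographic_product:
  assumes "d \<in> pverts D" "f \<in> pverts F" "d' \<in> pverts D" "f' \<in> pverts F"
  shows "(d', f') \<in> closed_out_nbhd (lexicographic_product D F) (d, f) \<longleftrightarrow>
    (d, d') \<in> parcs D \<or> d = d' \<and> f' \<in> closed_out_nbhd F f"
  using assms by (auto simp: closed_out_nbhd_def lexicographic_product_def)

text \<open>Expresses domination in the product through \<open>D\<close> and \<open>F\<close> alone;
  every later lemma starts from this form.\<close>

lemma ECD_lexicographic_product_iff:
  assumes "pair_digraph D" "pair_digraph F"
  shows "ECD_digraph (lexicographic_product D F) \<longleftrightarrow>
    (\<exists>S \<subseteq> pverts D \<times> pverts F. \<forall>d \<in> pverts D. \<forall>f \<in> pverts F.
      \<exists>!p. p \<in> S \<and> ((fst p, d) \<in> parcs D \<or> fst p = d \<and> f \<in> closed_out_nbhd F (snd p)))"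
proof -
  have "p \<in> S \<and> (d, f) \<in> closed_out_nbhd (lexicographic_product D F) p \<longleftrightarrow>
      p \<in> S \<and> ((fst p, d) \<in> parcs D \<or> fst p = d \<and> f \<in> closed_out_nbhd F (snd p))"
    if "S \<subseteq> pverts D \<times> pverts F" "d \<in> pverts D" "f \<in> pverts F" for S d f p
    using that by (cases p) (auto simp: mem_closed_out_nbhd_lexicographic_product subset_iff)
  moreover have "pverts (lexicographic_product D F) = pverts D \<times> pverts F"
    by (simp add: lexicographic_product_def)
  ultimately show ?thesis
    by (simp add: ECD_digraph_iff_dominated_once[OF pair_digraph_lexicographic_product[OF assms]]
        cong: conj_cong)
qed

text \<open>Without arcs in \<open>D\<close> the product is a disjoint union of copies of
  \<open>F\<close>, one per vertex of \<open>D\<close>. An ECD set restricts to any one copy;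
  conversely, an ECD set of \<open>F\<close> is repeated in all of them.\<close>

lemma ECD_digraph_lexicographic_product_arcless:
  assumes "pair_digraph D" "pverts D \<noteq> {}" "pair_digraph F" "parcs D = {}"
  shows "ECD_digraph (lexicographic_product D F) \<longleftrightarrow> ECD_digraph F"
proof
  assume "ECD_digraph (lexicographic_product D F)"
  then obtain S where S: "S \<subseteq> pverts D \<times> pverts F"
    and u: "\<forall>d \<in> pverts D. \<forall>f \<in> pverts F.
      \<exists>!p. p \<in> S \<and> fst p = d \<and> f \<in> closed_out_nbhd F (snd p)"
    unfolding ECD_lexicographic_product_iff[OF assms(1,3)] assms(4) empty_iff simp_thms
    by (elim exE conjE)
  from assms obtain d where d: "d \<in> pverts D" by blast
  have "\<exists>!g. g \<in> {g. (d, g) \<in> S} \<and> f \<in> closed_out_nbhd F g" if "f \<in> pverts F" for f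
    using u[rule_format, OF d that] by (metis fst_conv mem_Collect_eq prod.collapse snd_conv)
  with S show "ECD_digraph F"
    unfolding ECD_digraph_iff_dominated_once[OF assms(3)]
    by (intro exI[of _ "{g. (d, g) \<in> S}"]) auto
next
  assume "ECD_digraph F"
  then obtain S where S: "S \<subseteq> pverts F"
    and u: "\<forall>f \<in> pverts F. \<exists>!g. g \<in> S \<and> f \<in> closed_out_nbhd F g"
    unfolding ECD_digraph_iff_dominated_once[OF assms(3)] by (elim exE conjE)
  have "\<exists>!p. p \<in> pverts D \<times> S \<and> fst p = d \<and> f \<in> closed_out_nbhd F (snd p)"
    if "d \<in> pverts D" "f \<in> pverts F" for d f
    using u[rule_format, OF that(2)] that(1) by auto
  with S show "ECD_digraph (lexicographic_product D F)"
    unfolding ECD_lexicographic_product_iff[OF assms(1,3)] assms(4)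
    by (intro exI[of _ "pverts D \<times> S"]) auto
qed

text \<open>Since \<open>v\<close> is out-universal, \<open>(e, v)\<close> dominates the whole fibre
  over \<open>e\<close> as well as those over the out-neighbours of \<open>e\<close>. So
  \<open>T \<times> {v}\<close> dominates each fibre exactly as \<open>T\<close> dominates its base
  vertex.\<close>

lemma ECD_digraph_lexicographic_product_if_out_universal:
  assumes "pair_digraph D" "pair_digraph F" "ECD_digraph D" "out_universal F v"
  shows "ECD_digraph (lexicographic_product D F)"
proof -
  have dom: "f \<in> closed_out_nbhd F v" if "f \<in> pverts F" for f
    using assms that by (auto simp: out_universal_iff closed_out_nbhd_def)
  have v: "v \<in> pverts F"
    using assms by (simp add: out_universal_def)
  obtain T where T: "T \<subseteq> pverts D"
    and u: "\<And>d. d \<in> pverts D \<Longrightarrow> \<exists>!e. e \<in> T \<and> d \<in> closed_out_nbhd D e"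
    using assms by (auto simp: ECD_digraph_iff_dominated_once)
  have "\<exists>!p. p \<in> T \<times> {v} \<and> ((fst p, d) \<in> parcs D \<or> fst p = d \<and> f \<in> closed_out_nbhd F (snd p))"
    if "d \<in> pverts D" "f \<in> pverts F" for d f
    using u[OF that(1)] dom[OF that(2)] by (auto simp: closed_out_nbhd_def)
  with T v show ?thesis
    unfolding ECD_lexicographic_product_iff[OF assms(1,2)]
    by (intro exI[of _ "T \<times> {v}"]) auto
qed

lemma ECD_digraph_fst_if_ECD_digraph_lexicographic_product:
  assumes "pair_digraph D" "pair_digraph F" "pverts F \<noteq> {}"
    and "ECD_digraph (lexicographic_product D F)"
  shows "ECD_digraph D"
proof -
  obtain S where S: "S \<subseteq> pverts D \<times> pverts F"
    and u: "\<forall>d \<in> pverts D. \<forall>f \<in> pverts F.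
      \<exists>!p. p \<in> S \<and> ((fst p, d) \<in> parcs D \<or> fst p = d \<and> f \<in> closed_out_nbhd F (snd p))"
    using assms(4) unfolding ECD_lexicographic_product_iff[OF assms(1,2)]
    by (elim exE conjE)
  have "\<exists>!e. e \<in> fst ` S \<and> d \<in> closed_out_nbhd D e" if d: "d \<in> pverts D" for d
  proof -
    obtain f where "f \<in> pverts F" using assms(3) by blast
    then obtain p where p: "p \<in> S" "(fst p, d) \<in> parcs D \<or> fst p = d"
      using u[rule_format, OF d] by blast
    then have "d \<in> closed_out_nbhd D (fst p)"
      by (auto simp: closed_out_nbhd_def)
    \<comment> \<open>Several elements of \<open>S\<close> may lie over one vertex, so only their
      first coordinates can be shown equal.\<close>
    moreover have "fst q = fst r"
      if qr: "q \<in> S" "r \<in> S" "d \<in> closed_out_nbhd D (fst q)" "d \<in> closed_out_nbhd D (fst r)" for q r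
    proof (rule ccontr)
      assume ne: "fst q \<noteq> fst r"
      \<comment> \<open>At most one of \<open>q\<close>, \<open>r\<close> lies over \<open>d\<close>; if one does, its own second coordinate is a
        point of the fibre over \<open>d\<close> that both dominate.\<close>
      define g where "g = (if fst q = d then snd q else snd r)"
      have "g \<in> pverts F"
        using S qr by (auto simp: g_def)
      moreover have "(fst q, d) \<in> parcs D \<or> fst q = d \<and> g \<in> closed_out_nbhd F (snd q)"
        "(fst r, d) \<in> parcs D \<or> fst r = d \<and> g \<in> closed_out_nbhd F (snd r)"
        using qr ne by (auto simp: g_def closed_out_nbhd_def)
      ultimately show False
        using u[rule_format, OF d, of g] qr ne by blast
    qed
    ultimately show ?thesis
      using p(1) by blast
  qed
  with S show ?thesis
    unfolding ECD_digraph_iff_dominated_once[OF assms(1)]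
    by (intro exI[of _ "fst ` S"]) auto
qed

lemma out_universal_if_ECD_digraph_lexicographic_product:
  assumes "pair_digraph D" "pair_digraph F" "pverts F \<noteq> {}"
    and "ECD_digraph (lexicographic_product D F)" "parcs D \<noteq> {}"
  shows "\<exists>v. out_universal F v"
proof -
  interpret D: pair_digraph D by fact
  obtain S where S: "S \<subseteq> pverts D \<times> pverts F"
    and u: "\<forall>d \<in> pverts D. \<forall>f \<in> pverts F.
      \<exists>!p. p \<in> S \<and> ((fst p, d) \<in> parcs D \<or> fst p = d \<and> f \<in> closed_out_nbhd F (snd p))"
    using assms(4) unfolding ECD_lexicographic_product_iff[OF assms(1,2)]
    by (elim exE conjE)
  obtain f where f: "f \<in> pverts F" using assms(3) by blast
  obtain x y where "(x, y) \<in> parcs D" using assms(5) by auto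
  moreover from this obtain p where "p \<in> S" "(fst p, x) \<in> parcs D \<or> fst p = x"
    using u[rule_format, OF D.in_arcsD1 f] by blast
  \<comment> \<open>If \<open>p\<close> lies over an in-neighbour of \<open>x\<close>, then
    \<open>z\<close> is \<open>x\<close>; if it lies over \<open>x\<close> itself, \<open>z\<close>
    is \<open>y\<close>.\<close>
  ultimately obtain d g z where dg: "(d, g) \<in> S" and z: "(d, z) \<in> parcs D"
    by (cases p) auto
  have d: "d \<in> pverts D" and g: "g \<in> pverts F" using S dg by auto
  have "h \<in> closed_out_nbhd F g" if h: "h \<in> pverts F" for h
  proof -
    obtain p where p: "p \<in> S" "(fst p, d) \<in> parcs D \<or> fst p = d \<and> h \<in> closed_out_nbhd F (snd p)"
      using u[rule_format, OF d h] by blast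
    have "fst p = d"
    proof (rule ccontr)
      assume "fst p \<noteq> d"
      with p have "(fst p, d) \<in> parcs D" by simp
      moreover have "g \<in> closed_out_nbhd F g" by (simp add: closed_out_nbhd_def)
      \<comment> \<open>Both \<open>p\<close> and \<open>(d, g)\<close> dominate the vertex
        \<open>(d, g)\<close>.\<close>
      ultimately have "p = (d, g)"
        using u[rule_format, OF d g] p(1) dg by (metis fst_conv snd_conv)
      with \<open>fst p \<noteq> d\<close> show False by simp
    qed
    \<comment> \<open>Both lie over \<open>d\<close>, so both dominate
      \<open>(z, f)\<close>.\<close>
    moreover from this have "p = (d, g)"
      using u[rule_format, OF D.in_arcsD2[OF z] f] p(1) dg z by (metis fst_conv)
    \<comment> \<open>As \<open>d\<close> has no loop, \<open>(d, g)\<close> dominates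
      \<open>(d, h)\<close> only through \<open>F\<close>.\<close>
    ultimately show ?thesis
      using p(2) D.pair_no_loops[of "(d, d)"] by auto
  qed
  with g assms(2) show ?thesis
    by (auto simp: out_universal_iff closed_out_nbhd_def)
qed

text \<open>Both vertex sets are nonempty because an empty factor makes the product empty, and thus
  an ECD digraph whatever the other factor is.\<close>

theorem theorem11:
  fixes D :: "'a pair_pre_digraph" and F :: "'b pair_pre_digraph"
  assumes "pair_digraph D" and "pverts D \<noteq> {}"
    and "pair_digraph F" and "pverts F \<noteq> {}"
  shows "ECD_digraph (lexicographic_product D F) \<longleftrightarrow>
    (parcs D = {} \<and> ECD_digraph F) \<or> (ECD_digraph D \<and> (\<exists>v. out_universal F v))"
proof (cases "parcs D = {}")
  case True
  then show ?thesis
    using ECD_digraph_lexicographic_product_arcless[OF assms(1-3)]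
      ECD_digraph_lexicographic_product_if_out_universal[OF assms(1,3)] by blast
next
  case False
  then show ?thesis
    using ECD_digraph_lexicographic_product_if_out_universal[OF assms(1,3)]
      ECD_digraph_fst_if_ECD_digraph_lexicographic_product[OF assms(1,3,4)]
      out_universal_if_ECD_digraph_lexicographic_product[OF assms(1,3,4)] by blast
qed

end
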